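(* Let $m\ge1$, let $\Omega\subset\mathcal{O}\subset\mathbb{R}^{2m}$ be an open set and let $L_K\in\mathcal{L}_0(2m,\gamma,\lambda,\Lambda)$ be an integro-differential operator with a radially symmetric kernel $K$ such that $$\overline{K}(x,y)>\overline{K}(x,y^\star)\quad\text{for every }x,y\in\mathcal{O}.$$ Let $u\in C^{\alpha}(\Omega)\cap C(\overline{\Omega})\cap L^\infty(\mathbb{R}^{2m})$, with $\alpha>2\gamma$, be a doubly radial function which is odd with respect to the Simons cone. (i) (Weak maximum principle) Assume that $L_Ku+c(x)u\ge0$ in $\Omega$ and $u\ge0$ in $\mathcal{O}\setminus\Omega$, with $c\ge0$ in $\Omega$, and that either $\Omega$ is bounded or $\liminf_{x\in\mathcal{O},\,|x|\to+\infty}u(x)\ge0$. Then $u\ge0$ in $\Omega$. (ii) (Strong maximum principle) Assume that $L_Ku+c(x)u\ge0$ in $\Omega$, with $c$ any continuous function, and that $u\ge0$ in $\mathcal{O}$. Then either $u\equiv0$ in $\mathcal{O}$ or $u>0$ in $\Omega$.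
   Context: Points of $\mathbb{R}^{2m}$ are written $x=(x',x'')\in\mathbb{R}^m\times\mathbb{R}^m$; $x^\star:=(x'',x')$; $\mathscr{C}=\{|x'|=|x''|\}$ is the Simons cone and $\mathcal{O}=\{|x'|>|x''|\}$. A function $w$ on $\mathbb{R}^{2m}$ is doubly radial if $w(Rx)=w(x)$ for all $R\in O(m)^2=O(m)\times O(m)$ (acting blockwise), i.e. it depends only on $|x'|,|x''|$; a doubly radial $w$ is odd with respect to the Simons cone if $w(x)=-w(x^\star)$ for all $x$. For $n\ge1$, $\gamma\in(0,1)$, $0<\lambda\le\Lambda$, $\mathcal{L}_0(n,\gamma,\lambda,\Lambda)$ is the class of operators $L_Ku(x)=\mathrm{P.V.}\int_{\mathbb{R}^n}\{u(x)-u(y)\}K(x-y)\,dy$ with $K\ge0$, $K(z)=K(-z)$, $\int_{\mathbb{R}^n}\min\{|z|^2,1\}K(z)\,dz<\infty$, and $\lambda c_{n,\gamma}|z|^{-n-2\gamma}\le K(z)\le\Lambda c_{n,\gamma}|z|^{-n-2\gamma}$, where $c_{n,\gamma}>0$ is the normalizing constant of the fractional Laplacian $(-\Delta)^\gamma$ in $\mathbb{R}^n$. Radially symmetric means $K(z)=K(|z|)$. $\overline{K}(x,y):=\frac{1}{\mu(O(m)^2)}\int_{O(m)^2}K(|Rx-y|)\,dR\in(0,+\infty]$, where $dR$ is integration with respect to Haar measure $\mu$ on $O(m)^2$ (with $K(0)=+\infty$). For noninteger $\alpha>1$, $C^\alpha$ means $C^{\lfloor\alpha\rfloor,\alpha-\lfloor\alpha\rfloor}$.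 Since $u$ is only assumed measurable and bounded outside $\overline\Omega$, "$u\equiv0$ in $\mathcal{O}$" is understood almost everywhere. *)

theory Defs
  imports "HOL-Analysis.Analysis"
begin

section \<open>Doubly radial functions\<close>

text \<open>Points of \<open>\<real>\<^sup>2\<^sup>m\<close> are pairs \<open>(x', x'')\<close> of type \<open>(real^'m) \<times> (real^'m)\<close>, whose product norm
  is the Euclidean one.  The reflection \<open>x\<^sup>\<star> = (x'', x')\<close> is \<open>prod.swap x\<close>.\<close>

definition cone_side :: "((real^'m) \<times> (real^'m)) set" where
  "cone_side = {x. norm (snd x) < norm (fst x)}"

definition orth_pairs :: "((real^'m^'m) \<times> (real^'m^'m)) set" where
  "orth_pairs = {R. orthogonal_matrix (fst R) \<and> orthogonal_matrix (snd R)}"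

definition orth_mult ::
    "(real^'m^'m) \<times> (real^'m^'m) \<Rightarrow> (real^'m^'m) \<times> (real^'m^'m) \<Rightarrow> (real^'m^'m) \<times> (real^'m^'m)" where
  "orth_mult R S = (fst R ** fst S, snd R ** snd S)"

definition orth_act ::
    "(real^'m^'m) \<times> (real^'m^'m) \<Rightarrow> (real^'m) \<times> (real^'m) \<Rightarrow> (real^'m) \<times> (real^'m)" where
  "orth_act R x = (fst R *v fst x, snd R *v snd x)"

definition doubly_radial :: "((real^'m) \<times> (real^'m) \<Rightarrow> real) \<Rightarrow> bool" where
  "doubly_radial w \<longleftrightarrow> (\<forall>R\<in>orth_pairs. \<forall>x. w (orth_act R x) = w x)"

definition odd_wrt_cone :: "((real^'m) \<times> (real^'m) \<Rightarrow> real) \<Rightarrow> bool" where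
  "odd_wrt_cone w \<longleftrightarrow> (\<forall>x. w x = - w (prod.swap x))"


section \<open>Function spaces\<close>

text \<open>\<open>C\<^bsup>k,\<beta>\<^esup>(\<Omega>)\<close> for an open set \<open>\<Omega>\<close>, in the interior sense: the Hoelder condition is imposed on
  compact subsets of \<open>\<Omega>\<close> only.  For \<open>\<beta> = 0\<close> that condition follows from continuity, so the
  definition then reduces to \<open>C\<^sup>k(\<Omega>)\<close>.\<close>

fun C_k_holder :: "nat \<Rightarrow> real \<Rightarrow> 'a::euclidean_space set \<Rightarrow> ('a \<Rightarrow> real) \<Rightarrow> bool" where
  "C_k_holder 0 \<beta> \<Omega> f \<longleftrightarrow>
     continuous_on \<Omega> f \<and>
     (\<forall>S. compact S \<and> S \<subseteq> \<Omega> \<longrightarrow> (\<exists>C. \<forall>x\<in>S. \<forall>y\<in>S. \<bar>f x - f y\<bar> \<le> C * dist x y powr \<beta>))"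
| "C_k_holder (Suc k) \<beta> \<Omega> f \<longleftrightarrow>
     (\<forall>x\<in>\<Omega>. f differentiable (at x)) \<and>
     (\<forall>b\<in>Basis. C_k_holder k \<beta> \<Omega> (\<lambda>x. frechet_derivative f (at x) b))"

definition C_alpha :: "real \<Rightarrow> 'a::euclidean_space set \<Rightarrow> ('a \<Rightarrow> real) \<Rightarrow> bool" where
  "C_alpha \<alpha> \<Omega> f \<longleftrightarrow> C_k_holder (nat \<lfloor>\<alpha>\<rfloor>) (frac \<alpha>) \<Omega> f"

definition L_infinity :: "('a::euclidean_space \<Rightarrow> real) \<Rightarrow> bool" where
  "L_infinity f \<longleftrightarrow> f \<in> borel_measurable lebesgue \<and> (\<exists>B. AE x in lebesgue. \<bar>f x\<bar> \<le> B)"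


section \<open>The operators\<close>

text \<open>The constant with \<open>(-\<Delta>)\<^sup>\<gamma> u(x) = c\<^bsub>n,\<gamma>\<^esub> P.V. \<integral> (u(x) - u(y)) |x - y|\<^bsup>-n-2\<gamma>\<^esup> dy\<close> in \<open>\<real>\<^sup>n\<close>.\<close>

definition frac_lap_const :: "nat \<Rightarrow> real \<Rightarrow> real" where
  "frac_lap_const n \<gamma> =
     \<gamma> * 2 powr (2 * \<gamma>) * Gamma (real n / 2 + \<gamma>) / (pi powr (real n / 2) * Gamma (1 - \<gamma>))"

text \<open>Kernels of the class \<open>\<L>\<^sub>0(n, \<gamma>, \<lambda>, \<Lambda>)\<close>, with \<open>n\<close> the dimension of the space.  The two-sided
  bound makes a kernel finite off the origin, so it is a real-valued function whose value at \<open>0\<close>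
  carries no information; the convention \<open>K(0) = +\<infinity>\<close> is put into \<open>K_bar\<close> below.\<close>

definition kernel_L0 :: "real \<Rightarrow> real \<Rightarrow> real \<Rightarrow> ('a::euclidean_space \<Rightarrow> real) \<Rightarrow> bool" where
  "kernel_L0 \<gamma> lam Lam K \<longleftrightarrow>
     K \<in> borel_measurable lebesgue \<and>
     (\<forall>z. 0 \<le> K z) \<and>
     (\<forall>z. K z = K (- z)) \<and>
     integrable lebesgue (\<lambda>z. min ((norm z)\<^sup>2) 1 * K z) \<and>
     (\<forall>z. z \<noteq> 0 \<longrightarrow>
        lam * frac_lap_const DIM('a) \<gamma> * norm z powr (- real DIM('a) - 2 * \<gamma>) \<le> K z \<and>
        K z \<le> Lam * frac_lap_const DIM('a) \<gamma> * norm z powr (- real DIM('a) - 2 * \<gamma>))"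

definition radially_symmetric :: "('a::real_normed_vector \<Rightarrow> real) \<Rightarrow> bool" where
  "radially_symmetric K \<longleftrightarrow> (\<forall>z w. norm z = norm w \<longrightarrow> K z = K w)"

definition L_op :: "('a::euclidean_space \<Rightarrow> real) \<Rightarrow> ('a \<Rightarrow> real) \<Rightarrow> 'a \<Rightarrow> real" where
  "L_op K u x =
     Lim (at_right 0)
       (\<lambda>\<epsilon>. LINT y:{y. \<epsilon> < norm (x - y)}|lebesgue. (u x - u y) * K (x - y))"


section \<open>The averaged kernel\<close>

text \<open>Haar measures on the compact group \<open>O(m)\<^sup>2\<close>: nonzero, finite, left-invariant Borel measures.
  Regularity is automatic, the group being a compact metric space.\<close>

definition haar_measure :: "((real^'m^'m) \<times> (real^'m^'m)) measure \<Rightarrow> bool" where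
  "haar_measure \<mu> \<longleftrightarrow>
     space \<mu> = orth_pairs \<and>
     sets \<mu> = sets (restrict_space borel orth_pairs) \<and>
     emeasure \<mu> orth_pairs \<noteq> 0 \<and> emeasure \<mu> orth_pairs \<noteq> \<infinity> \<and>
     (\<forall>R\<in>orth_pairs. \<forall>A\<in>sets \<mu>. emeasure \<mu> (orth_mult R ` A) = emeasure \<mu> A)"

definition K_bar ::
    "((real^'m^'m) \<times> (real^'m^'m)) measure \<Rightarrow> ((real^'m) \<times> (real^'m) \<Rightarrow> real) \<Rightarrow>
     (real^'m) \<times> (real^'m) \<Rightarrow> (real^'m) \<times> (real^'m) \<Rightarrow> ennreal" where
  "K_bar \<mu> K x y =
     (\<integral>\<^sup>+R. (if orth_act R x = y then \<infinity> else ennreal (K (orth_act R x - y))) \<partial>\<mu>)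
       / emeasure \<mu> orth_pairs"

end

theory Submission imports Defs begin

text \<open>Both parts rest on one observation about a point \<open>x \<in> \<Omega>\<close> at which \<open>u\<close> attains a nonpositive
  minimum over \<open>\<O>\<close>.  The gradient of \<open>u\<close> vanishes there (if \<open>\<alpha> \<ge> 1\<close>), so
  \<open>|u x - u y| \<le> C |x - y|\<^bsup>\<beta>\<^esup>\<close> near \<open>x\<close> with \<open>\<beta> = min \<alpha> 2 > 2 \<gamma>\<close>, and \<open>(u x - u y) K (x - y)\<close> is
  absolutely integrable: no principal value is left.  With \<open>w = u - u x \<ge> 0\<close> on \<open>\<O>\<close>, oddness gives
  \<open>L\<^sub>K u x \<le> - \<integral>\<^sub>\<O> w y K (x - y) dy + \<integral>\<^sub>\<O> w y K (x - y\<^sup>\<star>) dy + 2 u x \<integral>\<^sub>\<O> K (x - y\<^sup>\<star>) dy\<close>.  Since \<open>w\<close> is doubly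
  radial, \<open>K\<close> may be replaced by its average in the first two integrals, and the kernel inequality
  makes their contribution nonpositive, and negative unless \<open>w = 0\<close> almost everywhere.\<close>

section \<open>Invariance of Lebesgue measure under isometries\<close>

lemma nn_integral_lborel_translate:
  fixes f :: "'a::euclidean_space \<Rightarrow> ennreal"
  assumes [measurable]: "f \<in> borel_measurable borel"
  shows "(\<integral>\<^sup>+x. f (c + x) \<partial>lborel) = (\<integral>\<^sup>+x. f x \<partial>lborel)"
proof -
  have "(\<integral>\<^sup>+x. f x \<partial>lborel) = (\<integral>\<^sup>+x. f x \<partial>distr lborel borel ((+) c))"
    by (simp add: lborel_distr_plus)
  also have "\<dots> = (\<integral>\<^sup>+x. f (c + x) \<partial>lborel)"
    by (subst nn_integral_distr) auto
  finally show ?thesis ..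
qed

lemma nn_integral_lborel_reflect:
  fixes f :: "'a::euclidean_space \<Rightarrow> ennreal"
  assumes [measurable]: "f \<in> borel_measurable borel"
  shows "(\<integral>\<^sup>+x. f (c - x) \<partial>lborel) = (\<integral>\<^sup>+x. f x \<partial>lborel)"
proof -
  have "(\<integral>\<^sup>+x. f x \<partial>lborel) = (\<integral>\<^sup>+x. f x \<partial>density (distr lborel borel (\<lambda>x. c + (-1) *\<^sub>R x)) (\<lambda>_. ennreal (\<bar>-1\<bar> ^ DIM('a))))"
    by (subst lborel_affine[of "-1" c]) auto
  also have "\<dots> = (\<integral>\<^sup>+x. f (c - x) \<partial>lborel)"
    by (simp add: nn_integral_density nn_integral_distr)
  finally show ?thesis ..
qed

text \<open>The uniqueness argument for translation-invariant measures: test \<open>f\<close> against the indicator of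
  the unit ball, which is \<open>T\<close>-invariant, and exchange the integrals.\<close>

lemma nn_integral_lborel_orthogonal:
  fixes f :: "'a::euclidean_space \<Rightarrow> ennreal" and T :: "'a \<Rightarrow> 'a"
  assumes [measurable]: "f \<in> borel_measurable borel" and T: "orthogonal_transformation T"
  shows "(\<integral>\<^sup>+x. f (T x) \<partial>lborel) = (\<integral>\<^sup>+x. f x \<partial>lborel)"
proof -
  define g :: "'a \<Rightarrow> ennreal" where "g = indicator (ball 0 1)"
  have [measurable]: "g \<in> borel_measurable borel" unfolding g_def by (intro borel_measurable_indicator) auto
  have lin: "linear T" using T by (rule orthogonal_transformation_linear)
  have [measurable]: "T \<in> borel_measurable borel"
    using lin by (intro borel_measurable_continuous_onI linear_continuous_on)
      (simp add: linear_conv_bounded_linear)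
  have gT: "g (T x) = g x" for x
    using orthogonal_transformation_norm[OF T, of x] by (simp add: g_def indicator_def)
  \<comment> \<open>Since \<open>T\<close> is onto, \<open>inv T y\<close> is a preimage of
    \<open>y\<close>; translating the integration variable by it turns \<open>T x\<close> into
    \<open>y + T x\<close> below.\<close>
  have inv: "T (inv T y + x) = y + T x" for x y
    using T linear_add[OF lin] by (simp add: orthogonal_transformation_surj surj_f_inv_f)
  let ?G = "\<integral>\<^sup>+y. g y \<partial>lborel"
  \<comment> \<open>The value shows that \<open>?G\<close> is finite and nonzero, so it can be
    cancelled at the end.\<close>
  have G: "?G = ennreal (unit_ball_vol (DIM('a)))"
    by (simp add: g_def emeasure_ball)
  have "(\<integral>\<^sup>+x. f (T x) \<partial>lborel) * ?G = (\<integral>\<^sup>+x. f (T x) * (\<integral>\<^sup>+y. g (T x - y) \<partial>lborel) \<partial>lborel)"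
    by (simp add: nn_integral_lborel_reflect nn_integral_multc)
  also have "\<dots> = (\<integral>\<^sup>+x. \<integral>\<^sup>+y. f (T x) * g (T x - y) \<partial>lborel \<partial>lborel)"
    by (simp add: nn_integral_cmult)
  also have "\<dots> = (\<integral>\<^sup>+y. \<integral>\<^sup>+x. f (T x) * g (T x - y) \<partial>lborel \<partial>lborel)"
    by (intro lborel_pair.Fubini'[symmetric]) measurable
  also have "\<dots> = (\<integral>\<^sup>+y. \<integral>\<^sup>+x. f (y + T x) * g x \<partial>lborel \<partial>lborel)"
  proof (rule nn_integral_cong)
    fix y
    have "(\<integral>\<^sup>+x. f (T (inv T y + x)) * g (T (inv T y + x) - y) \<partial>lborel)
        = (\<integral>\<^sup>+x. f (T x) * g (T x - y) \<partial>lborel)"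
      by (rule nn_integral_lborel_translate[where f = "\<lambda>x. f (T x) * g (T x - y)"]) measurable
    then show "(\<integral>\<^sup>+x. f (T x) * g (T x - y) \<partial>lborel) = (\<integral>\<^sup>+x. f (y + T x) * g x \<partial>lborel)"
      by (simp add: inv gT)
  qed
  also have "\<dots> = (\<integral>\<^sup>+x. \<integral>\<^sup>+y. f (y + T x) * g x \<partial>lborel \<partial>lborel)"
    by (intro lborel_pair.Fubini'[symmetric]) measurable
  also have "\<dots> = (\<integral>\<^sup>+x. (\<integral>\<^sup>+y. f (T x + y) \<partial>lborel) * g x \<partial>lborel)"
    by (simp add: nn_integral_multc add.commute)
  also have "\<dots> = (\<integral>\<^sup>+x. f x \<partial>lborel) * ?G"
    by (simp add: nn_integral_lborel_translate nn_integral_cmult)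
  finally show ?thesis
    using unit_ball_vol_pos[OF of_nat_0_le_iff, of "DIM('a)", THEN less_imp_neq]
    by (auto simp: G mult.commute[of _ "ennreal _"] ennreal_mult_cancel_left)
qed

text \<open>Measurability between completed spaces asks more than Borel measurability: preimages of
  null sets must be null. This holds because the map preserves \<open>lborel\<close>.\<close>

lemma
  fixes T :: "'a::euclidean_space \<Rightarrow> 'a"
  assumes T: "orthogonal_transformation T"
  shows lebesgue_measurable_isometry: "(\<lambda>x. c + T x) \<in> lebesgue \<rightarrow>\<^sub>M lebesgue"
    and lebesgue_distr_isometry: "distr lebesgue lebesgue (\<lambda>x. c + T x) = lebesgue"
proof -
  let ?S = "\<lambda>x. c + T x"
  have [measurable]: "T \<in> borel_measurable borel"
    using orthogonal_transformation_linear[OF T]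
    by (intro borel_measurable_continuous_onI linear_continuous_on)
      (simp add: linear_conv_bounded_linear)
  have S: "?S \<in> lborel \<rightarrow>\<^sub>M lborel" by simp
  have d: "distr lborel lborel ?S = lborel"
  proof (rule measure_eqI)
    fix A :: "'a set" assume "A \<in> sets (distr lborel lborel ?S)"
    then have [measurable]: "A \<in> sets borel" by simp
    have "emeasure (distr lborel lborel ?S) A = (\<integral>\<^sup>+x. indicator A x \<partial>distr lborel lborel ?S)"
      by simp
    also have "\<dots> = (\<integral>\<^sup>+x. indicator A (c + T x) \<partial>lborel)"
      by (subst nn_integral_distr) auto
    also have "\<dots> = (\<integral>\<^sup>+x. indicator A x \<partial>lborel)"
      by (subst nn_integral_lborel_orthogonal[OF _ T, where f = "\<lambda>x. indicator A (c + x)"])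
        (simp_all add: nn_integral_lborel_translate del: nn_integral_indicator)
    finally show "emeasure (distr lborel lborel ?S) A = emeasure lborel A" by simp
  qed simp
  have d': "distr lebesgue lborel ?S = lborel"
    using S d by (subst distr_completion) auto
  show 1: "?S \<in> lebesgue \<rightarrow>\<^sub>M lebesgue"
    using S d' by (intro completion.measurable_completion2) (auto simp: measurable_completion)
  show "distr lebesgue lebesgue ?S = lebesgue"
    using completion.completion_distr_eq[of ?S lborel lborel] S d' by (simp add: measurable_completion)
qed

text \<open>The form \<open>c + T x\<close> covers every substitution made later:
  \<open>x - y\<close> with \<open>T = uminus\<close>, the reflection \<open>prod.swap\<close>, and
  \<open>orth_act R\<close>, the last two with \<open>c = 0\<close>.\<close>

lemma
  fixes T :: "'a::euclidean_space \<Rightarrow> 'a"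
  assumes T: "orthogonal_transformation T"
  shows nn_integral_lebesgue_isometry:
      "f \<in> borel_measurable lebesgue \<Longrightarrow> (\<integral>\<^sup>+x. f (c + T x) \<partial>lebesgue) = (\<integral>\<^sup>+x. f x \<partial>lebesgue)"
    and AE_lebesgue_isometry: "(AE x in lebesgue. P x) \<Longrightarrow> (AE x in lebesgue. P (c + T x))"
    and borel_measurable_lebesgue_isometry:
      "g \<in> borel_measurable lebesgue \<Longrightarrow> (\<lambda>x. g (c + T x)) \<in> borel_measurable lebesgue"
    and integrable_lebesgue_isometry:
      "integrable lebesgue k \<Longrightarrow> integrable lebesgue (\<lambda>x. k (c + T x) :: real)"
proof -
  note m = lebesgue_measurable_isometry[OF T, of c] and d = lebesgue_distr_isometry[OF T, of c]
  show "f \<in> borel_measurable lebesgue \<Longrightarrow> (\<integral>\<^sup>+x. f (c + T x) \<partial>lebesgue) = (\<integral>\<^sup>+x. f x \<partial>lebesgue)"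
    using nn_integral_distr[OF m, of f] d by simp
  show "(AE x in lebesgue. P x) \<Longrightarrow> (AE x in lebesgue. P (c + T x))"
    using AE_distrD[OF m, of P] unfolding d .
  show "g \<in> borel_measurable lebesgue \<Longrightarrow> (\<lambda>x. g (c + T x)) \<in> borel_measurable lebesgue"
    using measurable_compose[OF m] by blast
  show "integrable lebesgue k \<Longrightarrow> integrable lebesgue (\<lambda>x. k (c + T x) :: real)"
    using integrable_distr[OF m, of k] unfolding d .
qed

lemma orthogonal_transformation_uminus:
  "orthogonal_transformation (uminus :: 'a::real_inner \<Rightarrow> 'a)"
  by (simp add: orthogonal_transformation_def linear_iff)

lemma orthogonal_transformation_swap:
  "orthogonal_transformation (prod.swap :: 'a::euclidean_space \<times> 'a \<Rightarrow> 'a \<times> 'a)"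
  by (simp add: orthogonal_transformation_def linear_iff inner_prod_def prod.swap_def)

lemmas nn_integral_lebesgue_reflect =
    nn_integral_lebesgue_isometry[OF orthogonal_transformation_uminus, unfolded add_uminus_conv_diff]
  and AE_lebesgue_reflect =
    AE_lebesgue_isometry[OF orthogonal_transformation_uminus, unfolded add_uminus_conv_diff]
  and borel_measurable_lebesgue_reflect =
    borel_measurable_lebesgue_isometry[OF orthogonal_transformation_uminus, unfolded add_uminus_conv_diff]
  and integrable_lebesgue_reflect =
    integrable_lebesgue_isometry[OF orthogonal_transformation_uminus, unfolded add_uminus_conv_diff]

lemmas nn_integral_lebesgue_swap =
    nn_integral_lebesgue_isometry[OF orthogonal_transformation_swap, where c = 0, unfolded add_0]
  and borel_measurable_lebesgue_swap =
    borel_measurable_lebesgue_isometry[OF orthogonal_transformation_swap, where c = 0, unfolded add_0]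

section \<open>The singularity at the origin and the principal value\<close>

text \<open>Dyadic decomposition: the volume \<open>2 ^ -(k n)\<close> of the k-th ball (up to a
  constant) cancels the growth of \<open>|z| ^ -n\<close>, where n is the dimension. What remains is
  a geometric series with ratio \<open>q = 2 powr (-\<delta>) < 1\<close>.\<close>

lemma nn_integral_norm_powr_ball_finite:
  fixes \<delta> :: real
  assumes "0 < \<delta>"
  shows "(\<integral>\<^sup>+z. indicator (ball 0 1) z * ennreal (norm z powr (\<delta> - DIM('a))) \<partial>(lborel :: 'a::euclidean_space measure)) < \<infinity>"
proof -
  let ?n = "real DIM('a)" and ?V = "unit_ball_vol (real DIM('a))"
  define q where "q = 2 powr (-\<delta>)"
  define a where "a k = q ^ k * 2 ^ (Suc k * DIM('a))" for k :: nat
  have q: "0 < q" "q < 1" using assms by (auto simp: q_def powr_less_one)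
  have a0: "a k \<ge> 0" for k using q by (simp add: a_def)
  \<comment> \<open>on the shell \<open>2\<^bsup>-k-1\<^esup> \<le> |z| < 2\<^bsup>-k\<^esup>\<close> the integrand is at most \<open>a k\<close>\<close>
  have le: "indicator (ball 0 1) z * ennreal (norm z powr (\<delta> - ?n))
      \<le> (\<Sum>k. ennreal (a k) * indicator (ball 0 ((1/2) ^ k)) z)" for z :: 'a
  proof (cases "z \<noteq> 0 \<and> norm z < 1")
    case True
    \<comment> \<open>Minimality places \<open>z\<close> in the k-th shell: the defining property
      bounds the norm from below, its failure at \<open>k - 1\<close> bounds it from above. For
      \<open>k = 0\<close> the upper bound is \<open>norm z < 1\<close>.\<close>
    define k where "k = (LEAST k. (1/2) ^ Suc k \<le> norm z)"
    obtain j where "(1/2::real) ^ j < norm z"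
      using real_arch_pow_inv[of "norm z" "1/2"] True by auto
    then have "(1/2::real) ^ Suc j \<le> norm z"
      using norm_ge_zero[of z] unfolding power_Suc by linarith
    then have k1: "(1/2) ^ Suc k \<le> norm z" unfolding k_def by (rule LeastI)
    have k2: "norm z < (1/2) ^ k"
    proof (cases k)
      case (Suc i)
      then have "\<not> (1/2) ^ Suc i \<le> norm z" using not_less_Least[of i "\<lambda>k. (1/2) ^ Suc k \<le> norm z"]
        by (simp add: k_def)
      then show ?thesis using Suc by simp
    qed (use True in simp)
    have "norm z powr (\<delta> - ?n) = norm z powr \<delta> * (1 / norm z) ^ DIM('a)"
      using True by (simp add: powr_diff powr_realpow power_one_over)
    also have "\<dots> \<le> ((1/2) ^ k) powr \<delta> * (2 ^ Suc k) ^ DIM('a)"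
    proof (intro mult_mono powr_mono2 power_mono)
      show "1 / norm z \<le> 2 ^ Suc k"
        using k1 True by (simp add: field_simps)
    qed (use k2 assms in auto)
    also have "((1/2::real) ^ k) powr \<delta> = q ^ k"
      by (simp add: q_def powr_realpow[symmetric] powr_powr powr_minus_divide powr_divide mult.commute
          flip: powr_numeral)
    finally have "norm z powr (\<delta> - ?n) \<le> a k" by (simp add: a_def power_mult power_add power_mult_distrib mult_ac)
    then have "indicator (ball 0 1) z * ennreal (norm z powr (\<delta> - ?n))
        \<le> ennreal (a k) * indicator (ball 0 ((1/2) ^ k)) z"
      using True k2 by (simp add: ennreal_leI)
    also have "\<dots> \<le> (\<Sum>k. ennreal (a k) * indicator (ball 0 ((1/2) ^ k)) z)"
      (is "?F k \<le> suminf ?F")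
    proof -
      have "sum ?F {k} \<le> suminf ?F" by (rule sum_le_suminf) auto
      then show ?thesis by (simp only: sum.insert finite.emptyI empty_iff sum.empty add_0_right not_False_eq_True)
    qed
    finally show ?thesis .
  qed (auto simp: indicator_def)
  have "(\<integral>\<^sup>+z. indicator (ball 0 1) z * ennreal (norm z powr (\<delta> - ?n)) \<partial>(lborel :: 'a measure))
      \<le> (\<integral>\<^sup>+z. (\<Sum>k. ennreal (a k) * indicator (ball 0 ((1/2) ^ k)) z) \<partial>(lborel :: 'a measure))"
    by (intro nn_integral_mono le)
  also have "\<dots> = (\<Sum>k. \<integral>\<^sup>+z. ennreal (a k) * indicator (ball 0 ((1/2) ^ k)) z \<partial>(lborel :: 'a measure))"
    by (intro nn_integral_suminf borel_measurable_times_ennreal borel_measurable_indicator) auto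
  also have "\<dots> = (\<Sum>k. ennreal (?V * 2 ^ DIM('a) * q ^ k))"
  proof (intro suminf_cong)
    fix k
    have "(\<integral>\<^sup>+z. ennreal (a k) * indicator (ball 0 ((1/2) ^ k)) z \<partial>(lborel :: 'a measure))
        = ennreal (a k) * ennreal (?V * ((1/2) ^ k) ^ DIM('a))"
      by (simp add: nn_integral_cmult_indicator emeasure_ball)
    also have "\<dots> = ennreal (a k * (?V * ((1/2) ^ k) ^ DIM('a)))"
      using a0 by (simp add: ennreal_mult)
    also have "a k * (?V * ((1/2) ^ k) ^ DIM('a)) = ?V * 2 ^ DIM('a) * q ^ k"
      by (simp add: a_def power_add power_mult power_divide flip: power_mult)
    finally show "(\<integral>\<^sup>+z. ennreal (a k) * indicator (ball 0 ((1/2) ^ k)) z \<partial>(lborel :: 'a measure))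
        = ennreal (?V * 2 ^ DIM('a) * q ^ k)" .
  qed
  also have "\<dots> = ennreal (\<Sum>k. ?V * 2 ^ DIM('a) * q ^ k)"
    using q by (intro suminf_ennreal2) (auto intro!: summable_mult summable_geometric)
  also have "\<dots> < \<infinity>" by simp
  finally show ?thesis .
qed

text \<open>Dominated convergence, with the absolute value of the full integrand as majorant. The
  truncations omit the point \<open>y = x\<close> for every \<epsilon>, but there the integrand is
  zero.\<close>

lemma L_op_eq_integral:
  assumes f: "integrable lebesgue (\<lambda>y. (u x - u y) * K (x - y))"
  shows "L_op K u x = (LINT y|lebesgue. (u x - u y) * K (x - y))"
proof -
  let ?f = "\<lambda>y. (u x - u y) * K (x - y)"
  let ?A = "\<lambda>\<epsilon>. {y. \<epsilon> < norm (x - y)}"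
  have meas: "?A \<epsilon> \<in> sets lebesgue" for \<epsilon>
  proof -
    have "open (?A \<epsilon>)" by (intro open_Collect_less continuous_intros)
    then show ?thesis by (simp add: borel_open)
  qed
  have "((\<lambda>\<epsilon>. LINT y:?A \<epsilon>|lebesgue. ?f y) \<longlongrightarrow> (LINT y|lebesgue. ?f y)) (at_right 0)"
    \<comment> \<open>The limit \<epsilon> to 0+ becomes t to infinity with \<epsilon> =
      \<open>inverse t\<close>, the form in which dominated convergence is available.\<close>
    unfolding filterlim_at_right_to_top set_lebesgue_integral_def
  proof (rule integral_dominated_convergence_at_top[where w = "\<lambda>y. norm (?f y)"])
    show "AE y in lebesgue. ((\<lambda>t. indicator (?A (inverse t)) y *\<^sub>R ?f y) \<longlongrightarrow> ?f y) at_top"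
    proof (rule AE_I2)
      fix y
      show "((\<lambda>t. indicator (?A (inverse t)) y *\<^sub>R ?f y) \<longlongrightarrow> ?f y) at_top"
      proof (cases "x = y")
        case False
        have "(inverse \<longlongrightarrow> (0::real)) at_top" by (rule tendsto_inverse_0_at_top[OF filterlim_ident])
        then have "\<forall>\<^sub>F t in at_top. inverse t < norm (x - y)"
          by (rule order_tendstoD) (use False in simp)
        then show ?thesis
          by (intro tendsto_eventually) (erule eventually_mono, simp)
      qed simp
    qed
    show "\<forall>\<^sub>F t in at_top. AE y in lebesgue. norm (indicator (?A (inverse t)) y *\<^sub>R ?f y) \<le> norm (?f y)"
      by (auto simp: indicator_def)
    show "(\<lambda>y. indicator (?A (inverse t)) y *\<^sub>R ?f y) \<in> borel_measurable lebesgue" for t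
      using meas f by (intro borel_measurable_scaleR borel_measurable_indicator) auto
  qed (use f in auto)
  then show ?thesis unfolding L_op_def by (intro tendsto_Lim) auto
qed

lemma frac_lap_const_pos:
  assumes "0 < \<gamma>" "\<gamma> < 1"
  shows "0 < frac_lap_const n \<gamma>"
  using assms by (auto simp: frac_lap_const_def intro!: mult_pos_pos divide_pos_pos Gamma_real_pos add_nonneg_pos)

section \<open>Regularity at a minimum\<close>

text \<open>Below order 1 the bound is the Hoelder condition itself. From order 1 on, the gradient
  vanishes at the minimum, so its modulus of continuity at \<open>x\<close> integrates to one more
  power of the distance. The exponent is capped at 2 because a vanishing gradient leaves a quadratic
  term.\<close>

lemma holder_at_local_min:
  fixes u :: "'a::euclidean_space \<Rightarrow> real"
  assumes \<alpha>: "0 < \<alpha>" and u: "C_alpha \<alpha> \<Omega> u" and \<Omega>: "open \<Omega>" "x \<in> \<Omega>"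
    and min: "\<And>y. y \<in> \<Omega> \<Longrightarrow> u x \<le> u y"
  obtains C r where "0 < r" "cball x r \<subseteq> \<Omega>" "0 \<le> C"
    "\<And>y. y \<in> cball x r \<Longrightarrow> \<bar>u x - u y\<bar> \<le> C * norm (x - y) powr (min \<alpha> 2)"
proof -
  obtain r0 where r0: "0 < r0" "cball x r0 \<subseteq> \<Omega>"
    using \<Omega> open_contains_cball by blast
  \<comment> \<open>The exponent for the gradient; it lies between 0 and 1 when \<alpha> is at least
    1.\<close>
  define \<beta> where "\<beta> = min \<alpha> 2 - 1"
  show ?thesis
  proof (cases "\<alpha> < 1")
    case True
    then have "nat \<lfloor>\<alpha>\<rfloor> = 0" "frac \<alpha> = \<alpha>" using \<alpha> by (auto simp: frac_eq)
    then obtain C where C: "\<And>y. y \<in> cball x r0 \<Longrightarrow> \<bar>u x - u y\<bar> \<le> C * dist x y powr \<alpha>"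
      using u r0 compact_cball[of x r0] unfolding C_alpha_def
      by (metis C_k_holder.simps(1) centre_in_cball less_imp_le)
    show ?thesis
    proof (rule that[of r0 "max C 0"])
      fix y assume "y \<in> cball x r0"
      then have "\<bar>u x - u y\<bar> \<le> C * dist x y powr \<alpha>" by (rule C)
      also have "\<dots> \<le> max C 0 * dist x y powr \<alpha>" by (intro mult_right_mono) auto
      finally show "\<bar>u x - u y\<bar> \<le> max C 0 * norm (x - y) powr min \<alpha> 2"
        using True by (simp add: dist_norm)
    qed (use r0 in auto)
  next
    case False
    \<comment> \<open>the partial derivatives vanish at \<open>x\<close> and are \<open>O(|x - y|\<^bsup>\<beta>\<^esup>)\<close>; integrate along segments\<close>
    define g where "g b y = frechet_derivative u (at y) b" for b y
    obtain k where k: "nat \<lfloor>\<alpha>\<rfloor> = Suc k" using False by (cases "nat \<lfloor>\<alpha>\<rfloor>") auto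
    have diff: "u differentiable (at y)" if "y \<in> \<Omega>" for y
      using u that by (simp add: C_alpha_def k)
    have hold: "C_k_holder k (frac \<alpha>) \<Omega> (g b)" if "b \<in> Basis" for b
      using u that by (simp add: C_alpha_def k g_def[abs_def])
    have der: "(u has_derivative (frechet_derivative u (at y))) (at y)" if "y \<in> \<Omega>" for y
      using diff[OF that] by (simp add: frechet_derivative_works)
    have "frechet_derivative u (at x) = (\<lambda>v. 0)"
      by (rule differential_zero_maxmin[OF \<Omega>(2,1) der[OF \<Omega>(2)]]) (use min in auto)
    then have g0: "g b x = 0" for b by (simp add: g_def)
    have "\<exists>C r. 0 < r \<and> r \<le> r0 \<and> (\<forall>y\<in>cball x r. \<bar>g b y\<bar> \<le> C * norm (x - y) powr \<beta>)" if b: "b \<in> Basis" for b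
    proof (cases k)
      case 0
      then have "\<lfloor>\<alpha>\<rfloor> = 1" using k by simp
      then have "frac \<alpha> = \<beta>" using floor_correct[of \<alpha>] by (auto simp: frac_def \<beta>_def)
      then obtain C where C: "\<And>y. y \<in> cball x r0 \<Longrightarrow> \<bar>g b x - g b y\<bar> \<le> C * dist x y powr \<beta>"
        using hold[OF b] r0 compact_cball[of x r0] 0
        by (metis C_k_holder.simps(1) centre_in_cball less_imp_le)
      show ?thesis
        using C r0 by (intro exI[of _ C] exI[of _ r0]) (auto simp: g0 dist_norm)
    next
      \<comment> \<open>Here \<alpha> is at least 2, so the partial derivatives are themselves
        differentiable at \<open>x\<close>. Since they vanish there, they grow at most linearly near
        \<open>x\<close>, which is the bound with exponent 1.\<close>
      case (Suc j)
      then have "\<lfloor>\<alpha>\<rfloor> \<ge> 2" using k by linarith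
      then have "\<alpha> \<ge> 2" by (simp add: le_floor_iff)
      then have \<beta>: "\<beta> = 1" by (simp add: \<beta>_def)
      have "g b differentiable (at x)"
        using hold[OF b] \<Omega> by (simp add: Suc)
      then obtain d where d: "(g b has_derivative d) (at x)" by (auto simp: differentiable_def)
      then have "bounded_linear d" by (rule has_derivative_bounded_linear)
      then obtain B where B: "0 < B" "\<And>v. norm (d v) \<le> norm v * B"
        using bounded_linear.pos_bounded by blast
      from d obtain s where s: "0 < s" "\<And>y. norm (y - x) < s \<Longrightarrow> norm (g b y - g b x - d (y - x)) \<le> 1 * norm (y - x)"
        unfolding has_derivative_at_alt using zero_less_one by blast
      show ?thesis
      proof (intro exI conjI ballI)
        \<comment> \<open>Halving \<open>s\<close> keeps the closed ball inside the open ball on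
          which the derivative estimate holds.\<close>
        show "0 < min r0 (s/2)" "min r0 (s/2) \<le> r0" using r0 s by auto
        fix y assume "y \<in> cball x (min r0 (s/2))"
        then have "norm (y - x) < s" using s(1) by (simp add: dist_norm norm_minus_commute)
        from s(2)[OF this] B(2)[of "y - x"]
        have "\<bar>g b y\<bar> \<le> (1 + B) * norm (y - x)" by (simp add: g0 algebra_simps)
        then show "\<bar>g b y\<bar> \<le> (1 + B) * norm (x - y) powr \<beta>"
          by (simp add: \<beta> norm_minus_commute)
      qed
    qed
    then obtain C r where Cr: "\<And>b. b \<in> Basis \<Longrightarrow> 0 < r b" "\<And>b. b \<in> Basis \<Longrightarrow> r b \<le> r0"
      "\<And>b y. b \<in> Basis \<Longrightarrow> y \<in> cball x (r b) \<Longrightarrow> \<bar>g b y\<bar> \<le> C b * norm (x - y) powr \<beta>"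
      by metis
    define s where "s = Min (r ` Basis)"
    have s: "0 < s" "\<And>b. b \<in> Basis \<Longrightarrow> s \<le> r b"
      using Cr(1) by (auto simp: s_def Min_gr_iff)
    have s_r0: "s \<le> r0"
      using nonempty_Basis s(2) Cr(2) by (meson ex_in_conv order_trans)
    define D where "D = (\<Sum>b\<in>Basis. \<bar>C b\<bar>)"
    have D: "0 \<le> D" by (simp add: D_def sum_nonneg)
    have \<beta>0: "\<beta> \<ge> 0" using False by (simp add: \<beta>_def)
    show ?thesis
    proof (rule that[of s D])
      fix y assume y: "y \<in> cball x s"
      show "\<bar>u x - u y\<bar> \<le> D * norm (x - y) powr (min \<alpha> 2)"
      proof (cases "y = x")
        case False
        let ?\<rho> = "norm (x - y)"
        let ?B = "D * ?\<rho> powr \<beta>"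
        have "norm (u x - u y) \<le> ?B * norm (x - y)"
        \<comment> \<open>The mean value inequality is applied on the ball of radius
          \<open>norm (x - y)\<close> rather than \<open>s\<close>, so that the gradient bound
          \<open>?B\<close> shrinks with the distance of \<open>y\<close> from
          \<open>x\<close>.\<close>
        proof (rule differentiable_bound)
          show "convex (cball x ?\<rho>)" by simp
          fix z assume z: "z \<in> cball x ?\<rho>"
          then have zs: "z \<in> cball x s" using y by (simp add: dist_norm)
          then have z\<Omega>: "z \<in> \<Omega>" using s_r0 r0 by auto
          show "(u has_derivative frechet_derivative u (at z)) (at z within cball x ?\<rho>)"
            using der[OF z\<Omega>] by (rule has_derivative_at_withinI)
          interpret bounded_linear "frechet_derivative u (at z)"
            using der[OF z\<Omega>] by (rule has_derivative_bounded_linear)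
          show "onorm (frechet_derivative u (at z)) \<le> ?B"
          proof (rule onorm_le)
            fix v
            have "frechet_derivative u (at z) v = frechet_derivative u (at z) (\<Sum>b\<in>Basis. (v \<bullet> b) *\<^sub>R b)"
              by (simp add: euclidean_representation)
            also have "\<dots> = (\<Sum>b\<in>Basis. (v \<bullet> b) * g b z)"
              by (simp add: sum scaleR g_def)
            finally have "norm (frechet_derivative u (at z) v) \<le> (\<Sum>b\<in>Basis. \<bar>(v \<bullet> b) * g b z\<bar>)"
              by simp
            also have "\<dots> \<le> (\<Sum>b\<in>Basis. norm v * (\<bar>C b\<bar> * ?\<rho> powr \<beta>))"
            proof (rule sum_mono)
              fix b :: 'a assume b: "b \<in> Basis"
              have "\<bar>g b z\<bar> \<le> C b * norm (x - z) powr \<beta>"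
                using Cr(3)[OF b] zs s(2)[OF b] by auto
              also have "\<dots> \<le> \<bar>C b\<bar> * ?\<rho> powr \<beta>"
                using z \<beta>0 by (intro mult_mono powr_mono2) (auto simp: dist_norm)
              finally show "\<bar>(v \<bullet> b) * g b z\<bar> \<le> norm v * (\<bar>C b\<bar> * ?\<rho> powr \<beta>)"
                using Basis_le_norm[OF b, of v] by (simp add: abs_mult mult_mono)
            qed
            also have "\<dots> = ?B * norm v"
              by (simp add: D_def sum_distrib_left sum_distrib_right mult_ac)
            finally show "norm (frechet_derivative u (at z) v) \<le> ?B * norm v" .
          qed
        qed (auto simp: dist_norm)
        also have "\<dots> = D * ?\<rho> powr (min \<alpha> 2)"
          using False powr_add[of ?\<rho> \<beta> 1] by (simp add: \<beta>_def)
        finally show ?thesis by simp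
      qed simp
    qed (use s s_r0 r0 D in auto)
  qed
qed

section \<open>The action of pairs of orthogonal matrices and the Simons cone\<close>

lemma orthogonal_transformation_orth_act:
  assumes "R \<in> orth_pairs"
  shows "orthogonal_transformation (orth_act R)"
proof -
  have "orthogonal_transformation ((*v) (fst R))" "orthogonal_transformation ((*v) (snd R))"
    using assms by (auto simp: orth_pairs_def orthogonal_transformation_matrix)
  then show ?thesis
    unfolding orthogonal_transformation_def
    by (simp add: orth_act_def linear_iff inner_prod_def)
qed

lemma norm_orth_act:
  assumes "R \<in> orth_pairs"
  shows "norm (fst (orth_act R x)) = norm (fst x)" "norm (snd (orth_act R x)) = norm (snd x)"
proof -
  have "orthogonal_transformation ((*v) (fst R))" "orthogonal_transformation ((*v) (snd R))"
    using assms by (auto simp: orth_pairs_def orthogonal_transformation_matrix)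
  then show "norm (fst (orth_act R x)) = norm (fst x)" "norm (snd (orth_act R x)) = norm (snd x)"
    by (simp_all add: orth_act_def orthogonal_transformation_norm)
qed

lemma orth_act_in_cone_side: "R \<in> orth_pairs \<Longrightarrow> orth_act R x \<in> cone_side \<longleftrightarrow> x \<in> cone_side"
  by (simp add: cone_side_def norm_orth_act)

lemma open_cone_side: "open (cone_side :: ((real^'m) \<times> (real^'m)) set)"
  unfolding cone_side_def by (intro open_Collect_less continuous_intros)

lemma swap_orth_act: "prod.swap (orth_act R x) = orth_act (prod.swap R) (prod.swap x)"
  by (simp add: orth_act_def prod.swap_def)

lemma swap_in_orth_pairs: "prod.swap R \<in> orth_pairs \<longleftrightarrow> R \<in> orth_pairs"
  by (auto simp: orth_pairs_def)

text \<open>On the cone, orthogonal maps carrying \<open>fst x\<close> to \<open>snd x\<close> and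
  back realise the reflection of \<open>x\<close>. Radiality then gives
  \<open>u (prod.swap x) = u x\<close>, while oddness gives the opposite sign.\<close>

lemma zero_on_cone:
  fixes u :: "(real^'m) \<times> (real^'m) \<Rightarrow> real"
  assumes u: "doubly_radial u" "odd_wrt_cone u" and x: "norm (fst x) = norm (snd x)"
  shows "u x = 0"
proof -
  obtain f where f: "orthogonal_transformation f" "f (fst x) = snd x"
    using orthogonal_transformation_exists[OF x] by blast
  obtain g where g: "orthogonal_transformation g" "g (snd x) = fst x"
    using orthogonal_transformation_exists[OF x[symmetric]] by blast
  let ?R = "(matrix f, matrix g)"
  have "?R \<in> orth_pairs"
    using f g by (simp add: orth_pairs_def orthogonal_transformation_matrix)
  moreover have "orth_act ?R x = prod.swap x"
    using f g by (simp add: orth_act_def matrix_works orthogonal_transformation_linear prod.swap_def)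
  ultimately have "u (prod.swap x) = u x"
    using u(1) by (metis doubly_radial_def)
  moreover have "u x = - u (prod.swap x)" using u(2) unfolding odd_wrt_cone_def by blast
  ultimately show ?thesis by simp
qed

section \<open>Averaging the kernel over Haar measure\<close>

lemma borel_measurable_orth_act:
  assumes "haar_measure \<mu>"
  shows "(\<lambda>R. orth_act R x) \<in> borel_measurable \<mu>"
proof -
  have "continuous_on UNIV (\<lambda>R. orth_act R x)"
    unfolding orth_act_def matrix_vector_mult_def
    by (intro continuous_intros continuous_on_vec_lambda)
  then have "(\<lambda>R. orth_act R x) \<in> borel_measurable (restrict_space borel orth_pairs)"
    by (intro measurable_restrict_space1 borel_measurable_continuous_onI)
  also have "borel_measurable (restrict_space borel orth_pairs) = (borel_measurable \<mu> :: (_ \<Rightarrow> (real^'a) \<times> (real^'a)) set)"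
    using assms by (intro measurable_cong_sets) (auto simp: haar_measure_def)
  finally show ?thesis .
qed

lemma borel_measurable_lebesgue_AE:
  fixes f g :: "'a::euclidean_space \<Rightarrow> 'b::topological_space"
  assumes "AE y in lebesgue. f y = g y" "f \<in> borel_measurable lebesgue"
  shows "g \<in> borel_measurable lebesgue"
proof (rule measurableI)
  fix A :: "'b set" assume "A \<in> sets borel"
  then have "f -` A \<inter> space lebesgue \<in> sets lebesgue"
    using assms(2) by (intro measurable_sets)
  then show "g -` A \<inter> space lebesgue \<in> sets lebesgue"
    by (rule completion.in_sets_AE[rotated]) (use assms(1) in auto)
qed simp

text \<open>Replacing \<open>x\<close> by \<open>orth_act R x\<close> does not change the integral
  of \<open>h y * K (x - y)\<close>: substitute \<open>orth_act R y\<close> for \<open>y\<close> and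
  use that \<open>h\<close> is invariant, \<open>K\<close> is radial and the action preserves
  distances. Averaging over \<open>R\<close> and exchanging the integrals produces
  \<open>K_bar\<close>.\<close>

lemma
  fixes K :: "(real^'m) \<times> (real^'m) \<Rightarrow> real" and h :: "(real^'m) \<times> (real^'m) \<Rightarrow> ennreal"
  assumes \<mu>: "haar_measure \<mu>" and rad: "radially_symmetric K" and K: "K \<in> borel_measurable lebesgue"
  shows borel_measurable_K_bar: "K_bar \<mu> K x \<in> borel_measurable lebesgue"
    and nn_integral_K_bar:
      "h \<in> borel_measurable lebesgue \<Longrightarrow> (\<And>R y. R \<in> orth_pairs \<Longrightarrow> h (orth_act R y) = h y) \<Longrightarrow>
        (\<integral>\<^sup>+y. h y * ennreal (K (x - y)) \<partial>lebesgue) = (\<integral>\<^sup>+y. h y * K_bar \<mu> K x y \<partial>lebesgue)"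
proof -
  have sp: "space \<mu> = orth_pairs" and M: "emeasure \<mu> orth_pairs \<noteq> 0" "emeasure \<mu> orth_pairs \<noteq> \<infinity>"
    using \<mu> by (auto simp: haar_measure_def)
  interpret \<mu>: finite_measure \<mu> by standard (use M sp in simp)
  interpret P: pair_sigma_finite \<mu> "lborel :: ((real^'m) \<times> (real^'m)) measure" ..
  note [measurable] = borel_measurable_orth_act[OF \<mu>, of x]
  have "(\<lambda>z. ennreal (K z)) \<in> borel_measurable lebesgue" using K by measurable
  from completion_ex_borel_measurable[OF this] obtain K'
    where K'[measurable]: "K' \<in> borel_measurable lborel" and KK': "AE z in lborel. ennreal (K z) = K' z" by blast
  \<comment> \<open>The origin is put into the exceptional set \<open>N\<close>, so that the
    infinite branch in \<open>K_bar\<close> occurs only where \<open>orth_act R x - y\<close> lies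
    in \<open>N\<close>.\<close>
  have "AE z in lborel. ennreal (K z) = K' z \<and> z \<noteq> 0"
    using KK' AE_lborel_singleton[of 0] by eventually_elim auto
  then obtain N
    where N: "\<And>z. z \<in> space lborel - N \<Longrightarrow> ennreal (K z) = K' z \<and> z \<noteq> 0" "N \<in> null_sets lborel"
    by (rule AE_E3) blast
  have [measurable]: "N \<in> sets borel" using N(2) by auto
  \<comment> \<open>\<open>K\<close> is only Lebesgue measurable, so \<open>R \<mapsto> K (R x - y)\<close> need not be measurable for every \<open>y\<close>;
    by Tonelli it agrees \<open>\<mu>\<close>-a.e. with the Borel version \<open>K'\<close> for almost every \<open>y\<close>\<close>
  define \<Phi> where "\<Phi> y = (\<integral>\<^sup>+R. K' (orth_act R x - y) \<partial>\<mu>)" for y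
  have [measurable]: "\<Phi> \<in> borel_measurable borel"
    unfolding \<Phi>_def by measurable
  have "AE R in \<mu>. AE y in lborel. orth_act R x - y \<notin> N"
  proof (rule AE_I2)
    fix R
    have "AE z in lebesgue. z \<notin> N" using N(2) by (simp add: AE_completion AE_not_in)
    then have "AE y in lebesgue. orth_act R x - y \<notin> N"
      by (rule AE_lebesgue_reflect)
    then show "AE y in lborel. orth_act R x - y \<notin> N" by (simp add: AE_completion_iff)
  qed
  then have "AE y in lborel. AE R in \<mu>. orth_act R x - y \<notin> N"
    by (subst (asm) P.AE_commute) measurable
  then have KN: "AE y in lborel. K_bar \<mu> K x y = \<Phi> y / emeasure \<mu> orth_pairs"
  proof eventually_elim
    case (elim y)
    have "(\<integral>\<^sup>+R. (if orth_act R x = y then \<infinity> else ennreal (K (orth_act R x - y))) \<partial>\<mu>) = \<Phi> y"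
      unfolding \<Phi>_def
    proof (rule nn_integral_cong_AE)
      show "AE R in \<mu>. (if orth_act R x = y then \<infinity> else ennreal (K (orth_act R x - y))) = K' (orth_act R x - y)"
        using elim
      proof eventually_elim
        case (elim R)
        then show ?case using N(1)[of "orth_act R x - y"] by auto
      qed
    qed
    then show ?case by (simp add: K_bar_def)
  qed
  have "AE y in lebesgue. \<Phi> y / emeasure \<mu> orth_pairs = K_bar \<mu> K x y"
    using KN by (intro AE_completion) (auto elim: eventually_mono)
  moreover have "(\<lambda>y. \<Phi> y / emeasure \<mu> orth_pairs) \<in> borel_measurable lebesgue"
    by (intro measurable_completion) measurable
  ultimately show mK: "K_bar \<mu> K x \<in> borel_measurable lebesgue"
    by (rule borel_measurable_lebesgue_AE)
  assume h: "h \<in> borel_measurable lebesgue" and hR: "\<And>R y. R \<in> orth_pairs \<Longrightarrow> h (orth_act R y) = h y"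
  from completion_ex_borel_measurable[OF h] obtain h'
    where h'[measurable]: "h' \<in> borel_measurable lborel" and hh': "AE z in lborel. h z = h' z" by blast
  let ?c = "\<integral>\<^sup>+y. h y * ennreal (K (x - y)) \<partial>lebesgue"
  have R: "(\<integral>\<^sup>+y. h' y * K' (orth_act R x - y) \<partial>lborel) = ?c" if R: "R \<in> orth_pairs" for R
  proof -
    note T = orthogonal_transformation_orth_act[OF R]
    have "AE y in lebesgue. ennreal (K (orth_act R x - y)) = K' (orth_act R x - y)"
      by (rule AE_lebesgue_reflect) (use KK' in \<open>rule AE_completion\<close>)
    then have "AE y in lborel. h' y * K' (orth_act R x - y) = h y * ennreal (K (orth_act R x - y))"
      using hh' unfolding AE_completion_iff by eventually_elim simp
    then have "(\<integral>\<^sup>+y. h' y * K' (orth_act R x - y) \<partial>lborel)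
        = (\<integral>\<^sup>+y. h y * ennreal (K (orth_act R x - y)) \<partial>lebesgue)"
      unfolding nn_integral_completion by (rule nn_integral_cong_AE)
    also have "\<dots> = (\<integral>\<^sup>+y. h (0 + orth_act R y) * ennreal (K (orth_act R x - (0 + orth_act R y))) \<partial>lebesgue)"
      by (intro nn_integral_lebesgue_isometry[OF T, symmetric] borel_measurable_times_ennreal h
          measurable_compose[OF borel_measurable_lebesgue_reflect[OF K] measurable_ennreal])
    also have "\<dots> = ?c"
    proof (rule nn_integral_cong)
      fix y
      have "orth_act R x - orth_act R y = orth_act R (x - y)"
        using T by (simp add: orthogonal_transformation_linear linear_diff)
      then have "norm (orth_act R x - orth_act R y) = norm (x - y)"
        using T by (simp add: orthogonal_transformation_norm)
      then have "K (orth_act R x - orth_act R y) = K (x - y)"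
        using rad unfolding radially_symmetric_def by blast
      then show "h (0 + orth_act R y) * ennreal (K (orth_act R x - (0 + orth_act R y)))
          = h y * ennreal (K (x - y))"
        by (simp add: hR[OF R])
    qed
    finally show ?thesis .
  qed
  let ?M = "emeasure \<mu> orth_pairs"
  have "(\<integral>\<^sup>+y. h y * K_bar \<mu> K x y \<partial>lebesgue) = (\<integral>\<^sup>+y. h' y * \<Phi> y / ?M \<partial>lborel)"
    unfolding nn_integral_completion
  proof (rule nn_integral_cong_AE)
    show "AE y in lborel. h y * K_bar \<mu> K x y = h' y * \<Phi> y / ?M"
      using KN hh' by eventually_elim (simp add: ennreal_times_divide)
  qed
  also have "\<dots> = (\<integral>\<^sup>+y. h' y * \<Phi> y \<partial>lborel) / ?M"
    by (rule nn_integral_divide) measurable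
  also have "(\<integral>\<^sup>+y. h' y * \<Phi> y \<partial>lborel) = (\<integral>\<^sup>+y. \<integral>\<^sup>+R. h' y * K' (orth_act R x - y) \<partial>\<mu> \<partial>lborel)"
    by (simp add: \<Phi>_def nn_integral_cmult)
  also have "\<dots> = (\<integral>\<^sup>+R. \<integral>\<^sup>+y. h' y * K' (orth_act R x - y) \<partial>lborel \<partial>\<mu>)"
    by (rule P.Fubini') measurable
  also have "\<dots> = (\<integral>\<^sup>+R. ?c \<partial>\<mu>)"
    by (intro nn_integral_cong R) (simp add: sp)
  also have "\<dots> / ?M = ?c"
    using M by (simp add: sp ennreal_mult_divide_eq)
  finally show "?c = (\<integral>\<^sup>+y. h y * K_bar \<mu> K x y \<partial>lebesgue)" ..
qed

section \<open>Kernel estimates and absolute integrability\<close>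

lemma kernel_pos:
  fixes K :: "'a::euclidean_space \<Rightarrow> real"
  assumes "kernel_L0 \<gamma> lam Lam K" "0 < \<gamma>" "\<gamma> < 1" "0 < lam" "z \<noteq> 0"
  shows "0 < K z"
proof -
  have "0 < lam * frac_lap_const DIM('a) \<gamma> * norm z powr (- real DIM('a) - 2 * \<gamma>)"
    using assms by (intro mult_pos_pos frac_lap_const_pos) auto
  also have "\<dots> \<le> K z" using assms by (simp add: kernel_L0_def)
  finally show ?thesis .
qed

text \<open>Outside a ball around the origin the weight \<open>min ((norm z)\<^sup>2) 1\<close> is
  bounded below, so integrability of the weighted kernel gives integrability of \<open>K\<close>
  itself there.\<close>

lemma kernel_away_le:
  assumes K: "\<And>z. 0 \<le> K z" and r: "0 < r" "r \<le> norm z"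
  shows "K z \<le> 1 / min (r\<^sup>2) 1 * (min ((norm z)\<^sup>2) 1 * K (z :: 'a::real_normed_vector) :: real)"
proof -
  have "r\<^sup>2 \<le> (norm z)\<^sup>2" using r by (intro power_mono) auto
  then have "min (r\<^sup>2) 1 * K z \<le> min ((norm z)\<^sup>2) 1 * K z"
    by (intro mult_right_mono K) auto
  moreover have "0 < min (r\<^sup>2) 1" using r by simp
  ultimately show ?thesis by (simp add: field_simps)
qed

text \<open>Near \<open>x\<close> the Hoelder bound times the upper kernel bound is a multiple of
  \<open>norm (x - y) powr (\<beta> - 2 * \<gamma> - n)\<close>, n the dimension, which is
  integrable because \<beta> exceeds 2 \<gamma>. Away from \<open>x\<close> the difference
  \<open>u x - u y\<close> is essentially bounded and the weighted kernel is integrable.\<close>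

lemma integrable_at_holder_point:
  fixes K u :: "'a::euclidean_space \<Rightarrow> real"
  assumes K: "kernel_L0 \<gamma> lam Lam K" and u: "L_infinity u"
    and \<beta>: "2 * \<gamma> < \<beta>" and r: "0 < r" and C: "0 \<le> C"
    and hold: "\<And>y. y \<in> cball x r \<Longrightarrow> \<bar>u x - u y\<bar> \<le> C * norm (x - y) powr \<beta>"
  shows "integrable lebesgue (\<lambda>y. (u x - u y) * K (x - y))"
proof -
  let ?n = "real DIM('a)"
  have K0: "0 \<le> K z" for z using K unfolding kernel_L0_def by blast
  have [measurable]: "K \<in> borel_measurable lebesgue" "u \<in> borel_measurable lebesgue"
    using K u by (auto simp: kernel_L0_def L_infinity_def)
  note [measurable] = borel_measurable_lebesgue_reflect[of K x]
  obtain B where B: "AE y in lebesgue. \<bar>u y\<bar> \<le> B" using u by (auto simp: L_infinity_def)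
  define D where "D = C * (Lam * frac_lap_const DIM('a) \<gamma>)"
  \<comment> \<open>A radius below 1 keeps the near region inside the unit ball, where the indicator
    in \<open>p\<close> equals 1.\<close>
  define s where "s = min r (1/2)"
  have s: "0 < s" "s \<le> r" "s < 1" using r by (auto simp: s_def)
  define p where "p z = indicator (ball 0 1) z * norm z powr (\<beta> - 2 * \<gamma> - ?n)" for z :: 'a
  define q where "q z = min ((norm z)\<^sup>2) 1 * K z" for z
  have "integrable lborel p"
  proof (rule integrableI_nonneg)
    show "p \<in> borel_measurable lborel"
      unfolding p_def
      by (intro borel_measurable_times borel_measurable_indicator powr_real_measurable) auto
    show "AE z in lborel. 0 \<le> p z" by (simp add: p_def)
    have "(\<integral>\<^sup>+z. ennreal (p z) \<partial>lborel)
        = (\<integral>\<^sup>+z. indicator (ball 0 1) z * ennreal (norm z powr (\<beta> - 2 * \<gamma> - ?n)) \<partial>(lborel :: 'a measure))"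
      by (intro nn_integral_cong) (auto simp: p_def indicator_def)
    also have "\<dots> < \<infinity>" using \<beta> by (intro nn_integral_norm_powr_ball_finite) simp
    finally show "(\<integral>\<^sup>+z. ennreal (p z) \<partial>lborel) < \<infinity>" .
  qed
  then have "integrable lebesgue p" by (simp add: integrable_completion)
  then have p: "integrable lebesgue (\<lambda>y. p (x - y))" by (rule integrable_lebesgue_reflect)
  have "integrable lebesgue q" using K by (simp add: kernel_L0_def q_def[abs_def])
  then have q: "integrable lebesgue (\<lambda>y. q (x - y))" by (rule integrable_lebesgue_reflect)
  define E where "E = (\<bar>u x\<bar> + \<bar>B\<bar>) * (1 / min (s\<^sup>2) 1)"
  have E0: "0 \<le> E" using s by (simp add: E_def)
  show ?thesis
  proof (rule Bochner_Integration.integrable_bound)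
    show "integrable lebesgue (\<lambda>y. \<bar>D\<bar> * p (x - y) + E * q (x - y))"
      using p q by simp
    show "(\<lambda>y. (u x - u y) * K (x - y)) \<in> borel_measurable lebesgue" by measurable
    show "AE y in lebesgue. norm ((u x - u y) * K (x - y)) \<le> norm (\<bar>D\<bar> * p (x - y) + E * q (x - y))"
      using B
    proof eventually_elim
      fix y assume By: "\<bar>u y\<bar> \<le> B"
      have q0: "0 \<le> E * q (x - y)" using K0 E0 by (simp add: q_def)
      have p0: "0 \<le> \<bar>D\<bar> * p (x - y)" by (simp add: p_def)
      have "\<bar>u x - u y\<bar> * K (x - y) \<le> \<bar>D\<bar> * p (x - y) + E * q (x - y)"
      proof (cases "norm (x - y) < s")
        case True
        have "\<bar>u x - u y\<bar> * K (x - y) \<le> \<bar>D\<bar> * p (x - y)"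
        proof (cases "x = y")
          case False
          let ?\<rho> = "norm (x - y)"
          have "\<bar>u x - u y\<bar> * K (x - y)
              \<le> (C * ?\<rho> powr \<beta>) * (Lam * frac_lap_const DIM('a) \<gamma> * ?\<rho> powr (- ?n - 2 * \<gamma>))"
            using K True False s K0 C by (intro mult_mono hold) (auto simp: kernel_L0_def dist_norm)
          also have "\<dots> = D * (?\<rho> powr \<beta> * ?\<rho> powr (- ?n - 2 * \<gamma>))"
            by (simp add: D_def)
          also have "?\<rho> powr \<beta> * ?\<rho> powr (- ?n - 2 * \<gamma>) = p (x - y)"
            using True s by (simp add: p_def algebra_simps flip: powr_add)
          also have "D * p (x - y) \<le> \<bar>D\<bar> * p (x - y)"
            by (intro mult_right_mono) (auto simp: p_def)
          finally show ?thesis .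
        qed (use p0 in simp)
        then show ?thesis using q0 by linarith
      next
        case False
        have "\<bar>u x - u y\<bar> * K (x - y) \<le> (\<bar>u x\<bar> + \<bar>B\<bar>) * (1 / min (s\<^sup>2) 1 * q (x - y))"
          unfolding q_def
          using By False s by (intro mult_mono kernel_away_le K0) auto
        also have "\<dots> = E * q (x - y)" by (simp add: E_def)
        finally show ?thesis using p0 by linarith
      qed
      then show "norm ((u x - u y) * K (x - y)) \<le> norm (\<bar>D\<bar> * p (x - y) + E * q (x - y))"
        using K0 by (simp add: abs_mult)
    qed
  qed
qed

section \<open>The operator at a nonpositive minimum\<close>

text \<open>If \<open>u x < 0\<close>, strictness comes from the term \<open>2 * u x * k\<close>
  with \<open>k > 0\<close>. If \<open>u x = 0\<close>, this term vanishes and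
  \<open>0 \<le> L_op K u x\<close> forces equality between the two averaged integrals, which the
  strict kernel inequality allows only for \<open>w = 0\<close> almost everywhere.\<close>

lemma L_op_at_minimum:
  fixes K u :: "(real^'m) \<times> (real^'m) \<Rightarrow> real"
  assumes \<gamma>: "0 < \<gamma>" "\<gamma> < 1" and lam: "0 < lam"
    and K: "kernel_L0 \<gamma> lam Lam K" and rad: "radially_symmetric K" and \<mu>: "haar_measure \<mu>"
    and KK: "\<And>x y. x \<in> cone_side \<Longrightarrow> y \<in> cone_side \<Longrightarrow> K_bar \<mu> K x y > K_bar \<mu> K x (prod.swap y)"
    and u: "L_infinity u" "doubly_radial u" "odd_wrt_cone u"
    and x: "x \<in> cone_side" "u x \<le> 0" "\<And>y. y \<in> cone_side \<Longrightarrow> u x \<le> u y"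
    and int: "integrable lebesgue (\<lambda>y. (u x - u y) * K (x - y))"
  shows "u x < 0 \<Longrightarrow> L_op K u x < 0"
    and "u x = 0 \<Longrightarrow> 0 \<le> L_op K u x \<Longrightarrow> AE y in lebesgue. y \<in> cone_side \<longrightarrow> u y = 0"
proof -
  let ?f = "\<lambda>y. (u x - u y) * K (x - y)"
  let ?O = "cone_side :: ((real^'m) \<times> (real^'m)) set"
  have K0: "0 \<le> K z" for z using K unfolding kernel_L0_def by blast
  have mK: "K \<in> borel_measurable lebesgue" and mu: "u \<in> borel_measurable lebesgue"
    using K u by (auto simp: kernel_L0_def L_infinity_def)
  have mO: "?O \<in> sets lebesgue" by (simp add: borel_open open_cone_side)
  have mO': "prod.swap -` ?O \<in> sets lebesgue"
  proof -
    have "open (prod.swap -` ?O)"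
      by (intro open_vimage open_cone_side continuous_on_swap)
    then show ?thesis by (simp add: borel_open)
  qed
  obtain r where r: "0 < r" "cball x r \<subseteq> ?O"
    using open_cone_side x(1) open_contains_cball by blast
  define \<kappa> where "\<kappa> y = indicator ?O (prod.swap y) * K (x - y)" for y
  \<comment> \<open>The kernel is singular only at \<open>y = x\<close>, and the reflected side
    stays outside \<open>cball x r\<close>.\<close>
  have int\<kappa>: "integrable lebesgue \<kappa>"
  proof (rule Bochner_Integration.integrable_bound)
    have "integrable lebesgue (\<lambda>z. min ((norm z)\<^sup>2) 1 * K z)" using K by (simp add: kernel_L0_def)
    then have "integrable lebesgue (\<lambda>y. min ((norm (x - y))\<^sup>2) 1 * K (x - y))"
      by (rule integrable_lebesgue_reflect)
    then show "integrable lebesgue (\<lambda>y. 1 / min (r\<^sup>2) 1 * (min ((norm (x - y))\<^sup>2) 1 * K (x - y)))"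
      by (rule integrable_mult_right)
    have "(\<lambda>y. indicator (prod.swap -` ?O) y * K (x - y)) \<in> borel_measurable lebesgue"
      by (intro borel_measurable_times borel_measurable_indicator mO' borel_measurable_lebesgue_reflect mK)
    then show "\<kappa> \<in> borel_measurable lebesgue"
      by (simp add: \<kappa>_def[abs_def] indicator_def)
    show "AE y in lebesgue. norm (\<kappa> y) \<le> norm (1 / min (r\<^sup>2) 1 * (min ((norm (x - y))\<^sup>2) 1 * K (x - y)))"
    proof (rule AE_I2)
      fix y
      let ?b = "1 / min (r\<^sup>2) 1 * (min ((norm (x - y))\<^sup>2) 1 * K (x - y))"
      have b0: "0 \<le> ?b" using K0 r by simp
      show "norm (\<kappa> y) \<le> norm ?b"
      proof (cases "prod.swap y \<in> ?O")
        case True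
        then have "y \<notin> ?O" by (simp add: cone_side_def)
        then have "r \<le> norm (x - y)" using r by (force simp: dist_norm)
        then have "K (x - y) \<le> ?b" by (intro kernel_away_le K0 r)
        then show ?thesis using True K0[of "x - y"] b0 by (simp add: \<kappa>_def)
      qed (simp add: \<kappa>_def)
    qed
  qed
  define k where "k = (LINT y|lebesgue. \<kappa> y)"
  have \<kappa>0: "0 \<le> \<kappa> y" for y by (simp add: \<kappa>_def K0)
  \<comment> \<open>Otherwise \<kappa> would vanish almost everywhere; as \<open>K\<close> is
    positive off the origin, the reflected side, a nonempty open set, would be null.\<close>
  have k: "0 < k"
  proof -
    have "k \<noteq> 0"
    proof
      assume "k = 0"
      then have "AE y in lebesgue. \<kappa> y = 0"
        using integral_nonneg_eq_0_iff_AE[OF int\<kappa>] \<kappa>0 by (simp add: k_def)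
      then have "AE y in lebesgue. y \<notin> prod.swap -` ?O"
      proof eventually_elim
        fix y assume y: "\<kappa> y = 0"
        show "y \<notin> prod.swap -` ?O"
        proof
          assume "y \<in> prod.swap -` ?O"
          then have "K (x - y) = 0" "y \<noteq> x" using y x(1) by (auto simp: \<kappa>_def cone_side_def)
          then show False using kernel_pos[OF K \<gamma> lam, of "x - y"] by simp
        qed
      qed
      then have "negligible (prod.swap -` ?O)"
        using mO' by (simp add: negligible_iff_null_sets AE_iff_null_sets)
      moreover have "open (prod.swap -` ?O)"
        by (intro open_vimage open_cone_side continuous_on_swap)
      moreover have "prod.swap x \<in> prod.swap -` ?O" using x(1) by simp
      ultimately show False using open_not_negligible by blast
    qed
    moreover have "0 \<le> k" using \<kappa>0 by (simp add: k_def)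
    ultimately show ?thesis by simp
  qed
  \<comment> \<open>The cutoff makes \<open>w\<close> nonnegative and doubly radial on the whole
    space, so \<open>nn_integral_K_bar\<close> applies to it and to its composition with
    \<open>prod.swap\<close>.\<close>
  define w where "w y = indicator ?O y * (u y - u x)" for y
  have w0: "0 \<le> w y" for y using x(3)[of y] by (auto simp: w_def indicator_def)
  have mw: "w \<in> borel_measurable lebesgue"
    unfolding w_def using mO mu by (intro borel_measurable_times borel_measurable_indicator borel_measurable_diff) auto
  have wR: "w (orth_act R y) = w y" if "R \<in> orth_pairs" for R y
  proof -
    have "u (orth_act R y) = u y" using that u(2) unfolding doubly_radial_def by blast
    then show ?thesis using orth_act_in_cone_side[OF that, of y] by (simp add: w_def indicator_def)
  qed
  define a where "a = (LINT y|lebesgue. w y * K (x - y))"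
  define b where "b = (LINT y|lebesgue. w (prod.swap y) * K (x - y))"
  have inta: "integrable lebesgue (\<lambda>y. w y * K (x - y))"
  proof -
    have "integrable lebesgue (\<lambda>y. - (indicator ?O y *\<^sub>R ?f y))"
      using integrable_mult_indicator[OF mO int] by simp
    then show ?thesis by (rule back_subst) (auto simp: w_def algebra_simps)
  qed
  \<comment> \<open>By oddness, \<open>w (prod.swap y) = - u y - u x\<close> on the reflected side,
    which differs from \<open>u x - u y\<close> by the constant \<open>2 * u x\<close>; this is
    where the \<kappa> term comes from.\<close>
  have intb: "integrable lebesgue (\<lambda>y. w (prod.swap y) * K (x - y))"
  proof -
    have "integrable lebesgue (\<lambda>y. indicator (prod.swap -` ?O) y *\<^sub>R ?f y - 2 * u x * \<kappa> y)"
      using integrable_mult_indicator[OF mO' int] int\<kappa> by simp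
    moreover have "indicator (prod.swap -` ?O) y *\<^sub>R ?f y - 2 * u x * \<kappa> y = w (prod.swap y) * K (x - y)" for y
    proof -
      have "u y = - u (prod.swap y)" using u(3) unfolding odd_wrt_cone_def by blast
      then show ?thesis by (auto simp: w_def \<kappa>_def indicator_def algebra_simps)
    qed
    ultimately show ?thesis by simp
  qed
  have L: "L_op K u x \<le> - a + b + 2 * u x * k"
  proof -
    have "L_op K u x = (LINT y|lebesgue. ?f y)" by (rule L_op_eq_integral[OF int])
    also have "\<dots> \<le> (LINT y|lebesgue. - (w y * K (x - y)) + w (prod.swap y) * K (x - y) + 2 * u x * \<kappa> y)"
    proof (rule integral_mono[OF int])
      show "integrable lebesgue (\<lambda>y. - (w y * K (x - y)) + w (prod.swap y) * K (x - y) + 2 * u x * \<kappa> y)"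
        using inta intb int\<kappa> by simp
      fix y
      have odd: "u y = - u (prod.swap y)" using u(3) unfolding odd_wrt_cone_def by blast
      \<comment> \<open>On the two sides the integrands agree. On the cone the right-hand one is
        zero and the left-hand one is \<open>u x * K (x - y)\<close>, which is nonpositive; hence an
        inequality.\<close>
      consider "y \<in> ?O" "prod.swap y \<notin> ?O" | "y \<notin> ?O" "prod.swap y \<in> ?O"
        | "y \<notin> ?O" "prod.swap y \<notin> ?O" "norm (fst y) = norm (snd y)"
        by (fastforce simp: cone_side_def)
      then show "?f y \<le> - (w y * K (x - y)) + w (prod.swap y) * K (x - y) + 2 * u x * \<kappa> y"
      proof cases
        case 3
        then have "u y = 0" using zero_on_cone u by blast
        then show ?thesis using 3 x(2) K0[of "x - y"] by (simp add: w_def \<kappa>_def mult_nonpos_nonneg)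
      qed (use odd in \<open>auto simp: w_def \<kappa>_def algebra_simps\<close>)
    qed
    also have "\<dots> = - a + b + 2 * u x * k"
      using inta intb int\<kappa> by (simp add: a_def b_def k_def)
    finally show ?thesis .
  qed
  let ?W = "\<lambda>y. ennreal (w y)"
  have mW: "?W \<in> borel_measurable lebesgue" using mw by measurable
  have mKb: "K_bar \<mu> K x \<in> borel_measurable lebesgue"
    by (rule borel_measurable_K_bar[OF \<mu> rad mK])
  have a: "ennreal a = (\<integral>\<^sup>+y. ?W y * K_bar \<mu> K x y \<partial>lebesgue)"
  proof -
    have "ennreal a = (\<integral>\<^sup>+y. ?W y * ennreal (K (x - y)) \<partial>lebesgue)"
      unfolding a_def using w0 K0 by (simp add: nn_integral_eq_integral[OF inta, symmetric] ennreal_mult)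
    also have "\<dots> = (\<integral>\<^sup>+y. ?W y * K_bar \<mu> K x y \<partial>lebesgue)"
      by (rule nn_integral_K_bar[OF \<mu> rad mK mW]) (simp add: wR)
    finally show ?thesis .
  qed
  have b: "ennreal b = (\<integral>\<^sup>+y. ?W y * K_bar \<mu> K x (prod.swap y) \<partial>lebesgue)"
  proof -
    have mWs: "(\<lambda>y. ?W (prod.swap y)) \<in> borel_measurable lebesgue"
      using mW by (rule borel_measurable_lebesgue_swap)
    have "ennreal b = (\<integral>\<^sup>+y. ?W (prod.swap y) * ennreal (K (x - y)) \<partial>lebesgue)"
      unfolding b_def using w0 K0 by (simp add: nn_integral_eq_integral[OF intb, symmetric] ennreal_mult)
    also have "\<dots> = (\<integral>\<^sup>+y. ?W (prod.swap y) * K_bar \<mu> K x y \<partial>lebesgue)"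
      by (rule nn_integral_K_bar[OF \<mu> rad mK mWs]) (simp add: wR swap_orth_act swap_in_orth_pairs)
    \<comment> \<open>Reflecting the variable moves the integral back to \<open>cone_side\<close>
      and puts the reflection into the second argument of \<open>K_bar\<close>, where
      \<open>KK\<close> can compare it with the integral for \<open>a\<close>.\<close>
    also have "\<dots> = (\<integral>\<^sup>+y. ?W (prod.swap (prod.swap y)) * K_bar \<mu> K x (prod.swap y) \<partial>lebesgue)"
      by (intro nn_integral_lebesgue_swap[symmetric] borel_measurable_times_ennreal mWs mKb)
    finally show ?thesis by simp
  qed
  have le: "?W y * K_bar \<mu> K x (prod.swap y) \<le> ?W y * K_bar \<mu> K x y" for y
    using KK[OF x(1), of y] by (cases "y \<in> ?O") (auto intro!: mult_left_mono simp: w_def)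
  have ab: "b \<le> a"
  proof -
    have "ennreal b \<le> ennreal a" unfolding a b by (intro nn_integral_mono le)
    moreover have "0 \<le> a" using w0 K0 by (simp add: a_def)
    ultimately show ?thesis by (simp add: ennreal_le_iff)
  qed
  show "u x < 0 \<Longrightarrow> L_op K u x < 0"
    using L ab k mult_neg_pos[of "u x" k] by simp
  assume ux: "u x = 0" and L0: "0 \<le> L_op K u x"
  have "a \<le> b" using L L0 ux by simp
  then have "\<not> ennreal b < ennreal a" by (simp add: ennreal_leI not_less)
  then have "AE y in lebesgue. ?W y * K_bar \<mu> K x y \<le> ?W y * K_bar \<mu> K x (prod.swap y)"
    unfolding a b
  \<comment> \<open>Strict inequality on a set of positive measure would separate the two integrals.
    This requires the smaller one to be finite, which holds because it equals
    \<open>ennreal b\<close>.\<close>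
  proof (rule contrapos_np)
    assume "\<not> (AE y in lebesgue. ?W y * K_bar \<mu> K x y \<le> ?W y * K_bar \<mu> K x (prod.swap y))"
    then show "(\<integral>\<^sup>+y. ?W y * K_bar \<mu> K x (prod.swap y) \<partial>lebesgue) < (\<integral>\<^sup>+y. ?W y * K_bar \<mu> K x y \<partial>lebesgue)"
      using le b
      by (intro nn_integral_less borel_measurable_times_ennreal mW mKb borel_measurable_lebesgue_swap[OF mKb])
        (auto simp flip: b)
  qed
  then show "AE y in lebesgue. y \<in> cone_side \<longrightarrow> u y = 0"
  proof eventually_elim
    fix y assume *: "?W y * K_bar \<mu> K x y \<le> ?W y * K_bar \<mu> K x (prod.swap y)"
    show "y \<in> cone_side \<longrightarrow> u y = 0"
    proof
      assume y: "y \<in> cone_side"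
      have "?W y * K_bar \<mu> K x y = ?W y * K_bar \<mu> K x (prod.swap y)"
        using * le by (rule antisym)
      \<comment> \<open>The factor \<open>?W y\<close> is finite, so if it were nonzero it could be
        cancelled, contradicting the strict inequality \<open>KK\<close>.\<close>
      then have "?W y = 0"
        using KK[OF x(1) y] by (auto simp: ennreal_mult_cancel_left)
      then show "u y = 0" using y x(3)[OF y] ux by (simp add: w_def)
    qed
  qed
qed

section \<open>Existence of the minimum and the two maximum principles\<close>

text \<open>A minimiser over a compact part of \<open>closure \<Omega>\<close> exists by continuity.
  Its value is negative, so it lies neither in \<open>cone_side - \<Omega>\<close>, where
  \<open>u\<close> is nonnegative, nor on the cone, where \<open>u\<close> vanishes; this leaves
  only \<Omega>.\<close>

lemma attains_negative_minimum:
  fixes \<Omega> :: "((real^'m) \<times> (real^'m)) set" and u :: "(real^'m) \<times> (real^'m) \<Rightarrow> real"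
  assumes \<Omega>: "\<Omega> \<subseteq> cone_side" and cont: "continuous_on (closure \<Omega>) u"
    and u: "doubly_radial u" "odd_wrt_cone u"
    and nonneg: "\<And>x. x \<in> cone_side - \<Omega> \<Longrightarrow> 0 \<le> u x"
    and inf: "bounded \<Omega> \<or> Liminf (inf at_infinity (principal cone_side)) (\<lambda>x. ereal (u x)) \<ge> 0"
    and z: "z \<in> \<Omega>" "u z < 0"
  obtains x where "x \<in> \<Omega>" "u x < 0" "\<And>y. y \<in> cone_side \<Longrightarrow> u x \<le> u y"
proof -
  \<comment> \<open>Beyond this radius no value of \<open>u\<close> on \<Omega> is below
    \<open>u z\<close>, so the minimisation may be restricted to a ball; for bounded \<Omega> the
    radius can be taken so large that the condition is vacuous.\<close>
  obtain \<rho> where \<rho>: "\<And>y. y \<in> \<Omega> \<Longrightarrow> \<rho> < norm y \<Longrightarrow> u z \<le> u y"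
    using inf
  proof
    assume "bounded \<Omega>"
    then obtain B where "\<And>y. y \<in> \<Omega> \<Longrightarrow> norm y \<le> B" by (auto simp: bounded_iff)
    then show thesis by (intro that[of B]) force
  next
    assume "Liminf (inf at_infinity (principal cone_side)) (\<lambda>x. ereal (u x)) \<ge> 0"
    moreover have "ereal (u z) < 0" using z by simp
    ultimately have "ereal (u z) < Liminf (inf at_infinity (principal cone_side)) (\<lambda>x. ereal (u x))"
      by (rule less_le_trans[rotated])
    then have "\<forall>\<^sub>F y in inf at_infinity (principal cone_side). ereal (u z) < ereal (u y)"
      by (rule less_LiminfD)
    then obtain B where "\<And>y. B \<le> norm y \<Longrightarrow> y \<in> cone_side \<Longrightarrow> u z < u y"
      by (auto simp: eventually_inf_principal eventually_at_infinity)
    then show thesis using \<Omega> by (intro that[of B]) (auto intro: less_imp_le)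
  qed
  \<comment> \<open>Taking the maximum with \<open>norm z\<close> ensures that \<open>z\<close>
    belongs to \<open>S\<close>, so the minimum is at most \<open>u z\<close>.\<close>
  define S where "S = closure \<Omega> \<inter> cball 0 (max \<rho> (norm z))"
  have zS: "z \<in> S" using z closure_subset by (auto simp: S_def)
  have "compact S" unfolding S_def by (intro closed_Int_compact) auto
  moreover have "continuous_on S u" by (rule continuous_on_subset[OF cont]) (simp add: S_def)
  ultimately obtain x where x: "x \<in> S" "\<And>y. y \<in> S \<Longrightarrow> u x \<le> u y"
    using continuous_attains_inf[of S u] zS by blast
  have xz: "u x \<le> u z" using x(2) zS by blast
  have "closure \<Omega> \<subseteq> {x. norm (snd x) \<le> norm (fst x)}"
  proof (rule closure_minimal)
    show "closed {x :: (real^'m) \<times> (real^'m). norm (snd x) \<le> norm (fst x)}"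
      by (intro closed_Collect_le continuous_intros)
  qed (use \<Omega> in \<open>auto simp: cone_side_def\<close>)
  then have xc: "norm (snd x) \<le> norm (fst x)" using x(1) by (auto simp: S_def)
  show thesis
  proof (rule that)
    show neg: "u x < 0" using xz z by simp
    show "x \<in> \<Omega>"
    proof (rule ccontr)
      assume "x \<notin> \<Omega>"
      show False
      proof (cases "x \<in> cone_side")
        case True
        then show False using nonneg[of x] \<open>x \<notin> \<Omega>\<close> neg by simp
      next
        case False
        then have "u x = 0" using xc by (intro zero_on_cone u) (simp add: cone_side_def)
        then show False using neg by simp
      qed
    qed
    fix y :: "(real^'m) \<times> (real^'m)" assume y: "y \<in> cone_side"
    consider "y \<notin> \<Omega>" | "y \<in> \<Omega>" "y \<in> S" | "y \<in> \<Omega>" "y \<notin> S" by blast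
    then show "u x \<le> u y"
    proof cases
      case 1
      then show ?thesis using nonneg[of y] y neg by simp
    next
      case 2
      then show ?thesis using x(2) by blast
    next
      case 3
      then have "\<rho> < norm y" using closure_subset by (auto simp: S_def)
      then show ?thesis using \<rho> 3 xz by fastforce
    qed
  qed
qed

theorem proposition1p2:
  fixes \<Omega> :: "((real^'m) \<times> (real^'m)) set"
    and K u :: "(real^'m) \<times> (real^'m) \<Rightarrow> real"
    and \<mu> :: "((real^'m^'m) \<times> (real^'m^'m)) measure"
    and \<gamma> lam Lam \<alpha> :: real
  assumes "open \<Omega>" and "\<Omega> \<subseteq> cone_side"
    and "0 < \<gamma>" and "\<gamma> < 1" and "0 < lam" and "lam \<le> Lam"
    and "kernel_L0 \<gamma> lam Lam K" and "radially_symmetric K"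
    and "haar_measure \<mu>"
    and "\<And>x y. x \<in> cone_side \<Longrightarrow> y \<in> cone_side \<Longrightarrow> K_bar \<mu> K x y > K_bar \<mu> K x (prod.swap y)"
    and "\<alpha> > 2 * \<gamma>" and "C_alpha \<alpha> \<Omega> u" and "continuous_on (closure \<Omega>) u" and "L_infinity u"
    and "doubly_radial u" and "odd_wrt_cone u"
  shows
    "(\<forall>c :: (real^'m) \<times> (real^'m) \<Rightarrow> real.
        (\<forall>x\<in>\<Omega>. L_op K u x + c x * u x \<ge> 0) \<and>
        (\<forall>x\<in>cone_side - \<Omega>. u x \<ge> 0) \<and>
        (\<forall>x\<in>\<Omega>. c x \<ge> 0) \<and>
        (bounded \<Omega> \<or> Liminf (inf at_infinity (principal cone_side)) (\<lambda>x. ereal (u x)) \<ge> 0)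
        \<longrightarrow> (\<forall>x\<in>\<Omega>. u x \<ge> 0)) \<and>
     (\<forall>c :: (real^'m) \<times> (real^'m) \<Rightarrow> real.
        (\<forall>x\<in>\<Omega>. L_op K u x + c x * u x \<ge> 0) \<and>
        continuous_on \<Omega> c \<and>
        (\<forall>x\<in>cone_side. u x \<ge> 0)
        \<longrightarrow> (AE x in lebesgue. x \<in> cone_side \<longrightarrow> u x = 0) \<or> (\<forall>x\<in>\<Omega>. u x > 0))"
proof -
  have integrable: "integrable lebesgue (\<lambda>y. (u x - u y) * K (x - y))"
    if x: "x \<in> \<Omega>" "\<And>y. y \<in> cone_side \<Longrightarrow> u x \<le> u y" for x
  proof -
    have "0 < \<alpha>" using assms(3,11) by simp
    moreover have "\<And>y. y \<in> \<Omega> \<Longrightarrow> u x \<le> u y" using x(2) assms(2) by blast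
    ultimately obtain C r where Cr: "0 < r" "0 \<le> C"
      "\<And>y. y \<in> cball x r \<Longrightarrow> \<bar>u x - u y\<bar> \<le> C * norm (x - y) powr (min \<alpha> 2)"
      using holder_at_local_min[OF _ assms(12,1) x(1)] by metis
    \<comment> \<open>The cap at 2 is harmless because \<gamma> is below 1.\<close>
    have "2 * \<gamma> < min \<alpha> 2" using assms(4,11) by simp
    then show ?thesis
      using Cr by (rule integrable_at_holder_point[OF assms(7,14)])
  qed
  note at_min = L_op_at_minimum[OF assms(3-5,7-10,14-16)]
  show ?thesis
  proof (intro conjI allI impI ballI; elim conjE)
    fix c :: "(real^'m) \<times> (real^'m) \<Rightarrow> real" and z
    assume L: "\<forall>x\<in>\<Omega>. L_op K u x + c x * u x \<ge> 0" and nonneg: "\<forall>x\<in>cone_side - \<Omega>. u x \<ge> 0"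
      and c: "\<forall>x\<in>\<Omega>. c x \<ge> 0"
      and inf: "bounded \<Omega> \<or> Liminf (inf at_infinity (principal cone_side)) (\<lambda>x. ereal (u x)) \<ge> 0"
      and z: "z \<in> \<Omega>"
    show "0 \<le> u z"
    proof (rule ccontr)
      assume "\<not> 0 \<le> u z"
      then obtain x where x: "x \<in> \<Omega>" "u x < 0" "\<And>y. y \<in> cone_side \<Longrightarrow> u x \<le> u y"
        using attains_negative_minimum[OF assms(2,13,15,16) _ inf z] nonneg by (metis not_le)
      then have "L_op K u x < 0"
        using assms(2) by (intro at_min(1) integrable) auto
      moreover have "c x * u x \<le> 0" using c x by (simp add: mult_nonneg_nonpos)
      ultimately show False using L x(1) by force
    qed
  next
    fix c :: "(real^'m) \<times> (real^'m) \<Rightarrow> real"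
    assume L: "\<forall>x\<in>\<Omega>. L_op K u x + c x * u x \<ge> 0" and nonneg: "\<forall>x\<in>cone_side. u x \<ge> 0"
    show "(AE x in lebesgue. x \<in> cone_side \<longrightarrow> u x = 0) \<or> (\<forall>x\<in>\<Omega>. u x > 0)"
    proof (rule disjCI)
      assume "\<not> (\<forall>x\<in>\<Omega>. u x > 0)"
      then obtain x where x: "x \<in> \<Omega>" "u x = 0" using nonneg assms(2) by force
      \<comment> \<open>At a zero of \<open>u\<close> the term \<open>c x * u x\<close> vanishes, so
        the hypothesis reads \<open>0 \<le> L_op K u x\<close>; the zero is a minimum over
        \<open>cone_side\<close> because \<open>u\<close> is nonnegative there.\<close>
      then show "AE x in lebesgue. x \<in> cone_side \<longrightarrow> u x = 0"
        using L nonneg assms(2) by (intro at_min(2)[of x] integrable) force+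
    qed
  qed
qed

end
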